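(* Let $F$ be a field. Let $C_0$ be a $4$-dimensional $F$-algebra with zero multiplication, and let $\{c_1,c_2,c_3,c_4\}$ be a basis for $C_0$. Let $C$ be the unitization of $C_0$. Then the matrix $$a=\begin{pmatrix} c_1 & c_2\\ c_3 & c_4\end{pmatrix}\in M_2(C)$$ cannot be written as a product of (finitely many) elements in $\mathrm{sl}_2(C)$. In particular, $a$ cannot be written as a product of (finitely many) commutators in $M_2(C)$.
   Context: The unitization of a nonunital $F$-algebra $B$ is the $F$-algebra $B\oplus F$ with product $(a,\lambda)(b,\mu)=(\mu a+\lambda b+ab,\lambda\mu)$ for $a,b\in B$, $\lambda,\mu\in F$; $B$ is identified with its image $B\oplus 0$. For a commutative $F$-algebra $C$, $\mathrm{sl}_2(C)\subseteq M_2(C)$ denotes the space of $2\times 2$ matrices over $C$ with trace zero. The commutator of $x,y$ in a ring is the additive commutator $[x,y]=xy-yx$. *)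

theory Defs
  imports "HOL-Analysis.Analysis"
begin

text \<open>
  A type class has only one type variable, so a ring that depends on a scalar field and an
  underlying vector space cannot be a class instance. The additive groups below are class
  instances; multiplications and units are explicit arguments.
\<close>

locale nonunital_algebra = vector_space smul
  for smul :: "'f::field \<Rightarrow> 'b::ab_group_add \<Rightarrow> 'b" +
  fixes mul :: "'b \<Rightarrow> 'b \<Rightarrow> 'b"
  assumes mul_assoc: "mul (mul x y) z = mul x (mul y z)"
    and mul_add_left: "mul (x + y) z = mul x z + mul y z"
    and mul_add_right: "mul x (y + z) = mul x y + mul x z"
    and mul_scale_left: "mul (smul r x) y = smul r (mul x y)"
    and mul_scale_right: "mul x (smul r y) = smul r (mul x y)"

text \<open>
  The unitization lives on the type \<open>'b \<times> 'f\<close>, with its componentwise additive structure.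
  An element \<open>b\<close> of the algebra is identified with \<open>(b, 0)\<close>.
\<close>

definition unitization_mult ::
  "('f::field \<Rightarrow> 'b::ab_group_add \<Rightarrow> 'b) \<Rightarrow> ('b \<Rightarrow> 'b \<Rightarrow> 'b) \<Rightarrow> 'b \<times> 'f \<Rightarrow> 'b \<times> 'f \<Rightarrow> 'b \<times> 'f"
  where "unitization_mult smul mul x y =
    (smul (snd y) (fst x) + smul (snd x) (fst y) + mul (fst x) (fst y), snd x * snd y)"

definition unitization_one :: "'b::ab_group_add \<times> 'f::field"
  where "unitization_one = (0, 1)"

text \<open>
  The library's matrix product, identity matrix and trace require a class instance for the
  entries; these are the same formulas for entries with an explicit multiplication and unit.
\<close>

definition mat_mult :: "('c::ab_group_add \<Rightarrow> 'c \<Rightarrow> 'c) \<Rightarrow> 'c^'n^'n \<Rightarrow> 'c^'n^'n \<Rightarrow> 'c^'n^'n"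
  where "mat_mult mul A B = (\<chi> i j. \<Sum>k\<in>UNIV. mul (A $ i $ k) (B $ k $ j))"

definition mat_one :: "'c::ab_group_add \<Rightarrow> 'c^'n^'n"
  where "mat_one e = (\<chi> i j. if i = j then e else 0)"

definition mat_trace :: "'c::ab_group_add^'n^'n \<Rightarrow> 'c"
  where "mat_trace A = (\<Sum>i\<in>UNIV. A $ i $ i)"

definition sl2 :: "('c::ab_group_add^2^2) set"
  where "sl2 = {A. mat_trace A = 0}"

definition commutator :: "('r::ab_group_add \<Rightarrow> 'r \<Rightarrow> 'r) \<Rightarrow> 'r \<Rightarrow> 'r \<Rightarrow> 'r"
  where "commutator mul x y = mul x y - mul y x"

definition commutators :: "('r::ab_group_add \<Rightarrow> 'r \<Rightarrow> 'r) \<Rightarrow> 'r set"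
  where "commutators mul = {commutator mul x y |x y. True}"

text \<open>The set of all \<open>s\<^sub>1 \<cdots> s\<^sub>n\<close> with factors in \<open>S\<close>; the empty product is the unit \<open>e\<close>.\<close>

definition finite_products :: "('r \<Rightarrow> 'r \<Rightarrow> 'r) \<Rightarrow> 'r \<Rightarrow> 'r set \<Rightarrow> 'r set"
  where "finite_products mul e S = {foldr mul xs e |xs. set xs \<subseteq> S}"

lemma (in nonunital_algebra) unitization_ring_1:
  "class.ring_1 unitization_one (unitization_mult smul mul) (+) 0 (-) uminus"
proof -
  have [simp]: "mul 0 x = 0" "mul x 0 = 0" for x
    using mul_add_left[of 0 0 x] mul_add_right[of x 0 0] by simp_all
  show ?thesis
    by unfold_locales
      (auto simp: unitization_mult_def unitization_one_def zero_prod_def algebra_simps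
        mul_assoc mul_add_left mul_add_right mul_scale_left mul_scale_right)
qed

lemma (in nonunital_algebra) unitization_commute:
  assumes "\<And>x y. mul x y = mul y x"
  shows "unitization_mult smul mul x y = unitization_mult smul mul y x"
  using assms by (simp add: unitization_mult_def add.commute mult.commute)

lemma mat_ring_1:
  fixes mul :: "'c::ab_group_add \<Rightarrow> 'c \<Rightarrow> 'c"
  assumes "class.ring_1 e mul (+) 0 (-) uminus"
  shows "class.ring_1 (mat_one e :: 'c^'n^'n) (mat_mult mul) (+) 0 (-) uminus"
proof -
  interpret R: ring_1 e mul "(+)" 0 "(-)" uminus by (fact assms)
  have sum_left: "mul (\<Sum>k\<in>A. f k) x = (\<Sum>k\<in>A. mul (f k) x)"
    and sum_right: "mul x (\<Sum>k\<in>A. f k) = (\<Sum>k\<in>A. mul x (f k))"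
    for f :: "'n \<Rightarrow> 'c" and x and A
    by (induction A rule: infinite_finite_induct)
      (simp_all add: R.distrib_left R.distrib_right)
  show ?thesis
  proof
    fix A B D :: "'c^'n^'n"
    show "mat_mult mul (mat_mult mul A B) D = mat_mult mul A (mat_mult mul B D)"
      by (simp add: mat_mult_def vec_eq_iff sum_left sum_right R.mult.assoc)
        (intro allI sum.swap)
    show "mat_mult mul (mat_one e) A = A"
    proof -
      have "mul (if i = k then e else 0) x = (if k = i then x else 0)" for i k :: 'n and x
        by simp
      then show ?thesis
        by (simp add: mat_mult_def mat_one_def vec_eq_iff del: if_split)
    qed
    show "mat_mult mul A (mat_one e) = A"
    proof -
      have "mul x (if k = j then e else 0) = (if k = j then x else 0)" for j k :: 'n and x
        by simp
      then show ?thesis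
        by (simp add: mat_mult_def mat_one_def vec_eq_iff del: if_split)
    qed
    show "mat_mult mul (A + B) D = mat_mult mul A D + mat_mult mul B D"
      by (simp add: mat_mult_def vec_eq_iff R.distrib_right sum.distrib)
    show "mat_mult mul A (B + D) = mat_mult mul A B + mat_mult mul A D"
      by (simp add: mat_mult_def vec_eq_iff R.distrib_left sum.distrib)
    show "(0 :: 'c^'n^'n) \<noteq> mat_one e"
      using R.zero_neq_one by (auto simp: mat_one_def vec_eq_iff)
  qed
qed

end

theory Submission
  imports Defs
begin

text \<open>
  Write \<open>x = (x\<^sub>1, x\<^sub>0)\<close> for a matrix over \<open>C = C\<^sub>0 \<oplus> F\<close>, with \<open>x\<^sub>1\<close> over \<open>C\<^sub>0\<close> and \<open>x\<^sub>0\<close> over \<open>F\<close>.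
  Since \<open>C\<^sub>0\<close> has zero multiplication, \<open>(xy)\<^sub>0 = x\<^sub>0 y\<^sub>0\<close> and \<open>(xy)\<^sub>1 = x\<^sub>0 y\<^sub>1 + x\<^sub>1 y\<^sub>0\<close>.
  By induction on its length, a product \<open>z\<close> of trace zero matrices with \<open>z\<^sub>0 = 0\<close> satisfies
  \<open>tr (M z\<^sub>1) = 0\<close> for some matrix \<open>M \<noteq> 0\<close> over \<open>F\<close>. Indeed, let \<open>z = xy\<close> with first factor \<open>x\<close>,
  so that \<open>tr (M z\<^sub>1) = tr (M x\<^sub>0 y\<^sub>1) + tr (y\<^sub>0 M x\<^sub>1)\<close>.
  If \<open>x\<^sub>0\<close> is invertible, then \<open>y\<^sub>0 = 0\<close> and \<open>M = N x\<^sub>0\<inverse>\<close> works, where \<open>N\<close> belongs to \<open>y\<close>.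
  If \<open>y\<^sub>0\<close> is invertible, then \<open>x\<^sub>0 = 0\<close> and \<open>M = y\<^sub>0\<inverse>\<close> works because \<open>tr x\<^sub>1 = 0\<close>.
  If both are singular, some \<open>M \<noteq> 0\<close> satisfies \<open>M x\<^sub>0 = 0\<close> and \<open>y\<^sub>0 M = 0\<close>.
  For \<open>z = a\<close>, the relation \<open>tr (M z\<^sub>1) = 0\<close> is a nontrivial linear relation between the \<open>c\<^sub>i\<close>.
\<close>

definition scalar_part :: "('b \<times> 'f)^'n^'n \<Rightarrow> 'f^'n^'n"
  where "scalar_part x = (\<chi> i j. snd (x $ i $ j))"

text \<open>This is \<open>tr (M x\<^sub>1)\<close>, with scalars acting on the entries of
  \<open>x\<^sub>1\<close> by \<open>smul\<close>.\<close>

definition trace_pairing ::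
  "('f::field \<Rightarrow> 'b::ab_group_add \<Rightarrow> 'b) \<Rightarrow> 'f^'n^'n \<Rightarrow> ('b \<times> 'f)^'n^'n \<Rightarrow> 'b"
  where "trace_pairing smul M x = (\<Sum>i\<in>UNIV. \<Sum>j\<in>UNIV. smul (M $ i $ j) (fst (x $ j $ i)))"

lemma scalar_part_mult:
  "scalar_part (mat_mult (unitization_mult smul mul) x y) = scalar_part x ** scalar_part y"
  by (simp add: scalar_part_def mat_mult_def matrix_matrix_mult_def vec_eq_iff snd_sum
      unitization_mult_def)

lemma scalar_part_one: "scalar_part (mat_one unitization_one) = mat 1"
  by (auto simp: scalar_part_def mat_one_def unitization_one_def mat_def vec_eq_iff)

context vector_space
begin

lemma trace_pairing_mult:
  assumes "\<And>x y. mul x y = 0"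
  shows "trace_pairing scale M (mat_mult (unitization_mult scale mul) x y) =
    trace_pairing scale (M ** scalar_part x) y + trace_pairing scale (scalar_part y ** M) x"
proof -
  have "trace_pairing scale M (mat_mult (unitization_mult scale mul) x y) =
     (\<Sum>i\<in>UNIV. \<Sum>j\<in>UNIV. \<Sum>k\<in>UNIV. scale (M $ i $ j * snd (x $ j $ k)) (fst (y $ k $ i))) +
     (\<Sum>i\<in>UNIV. \<Sum>j\<in>UNIV. \<Sum>k\<in>UNIV. scale (snd (y $ k $ i) * M $ i $ j) (fst (x $ j $ k)))"
    by (simp add: trace_pairing_def mat_mult_def unitization_mult_def assms fst_sum
        scale_sum_right scale_right_distrib sum.distrib mult.commute[of "M $ _ $ _" "snd _"])
  also have "(\<Sum>i\<in>UNIV. \<Sum>j\<in>UNIV. \<Sum>k\<in>UNIV. scale (M $ i $ j * snd (x $ j $ k)) (fst (y $ k $ i))) =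
     trace_pairing scale (M ** scalar_part x) y"
    by (simp add: trace_pairing_def scalar_part_def matrix_matrix_mult_def scale_sum_left)
      (intro sum.cong refl sum.swap)
  also have "(\<Sum>i\<in>UNIV. \<Sum>j\<in>UNIV. \<Sum>k\<in>UNIV. scale (snd (y $ k $ i) * M $ i $ j) (fst (x $ j $ k))) =
     (\<Sum>k\<in>UNIV. \<Sum>j\<in>UNIV. \<Sum>i\<in>UNIV. scale (snd (y $ k $ i) * M $ i $ j) (fst (x $ j $ k)))"
    \<comment> \<open>Reversing the order of summation gives the cyclicity of the trace:
      \<open>y\<^sub>0\<close> moves from behind \<open>x\<^sub>1\<close> to the front of
      \<open>M\<close>.\<close>
    by (subst sum.swap, subst (2) sum.swap, subst sum.swap) (rule refl)
  also have "\<dots> = trace_pairing scale (scalar_part y ** M) x"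
    by (simp add: trace_pairing_def scalar_part_def matrix_matrix_mult_def scale_sum_left)
  finally show ?thesis .
qed

lemma trace_pairing_zero: "trace_pairing scale 0 x = 0"
  by (simp add: trace_pairing_def)

lemma trace_pairing_one:
  fixes x :: "('b \<times> 'a)^'n^'n"
  shows "trace_pairing scale (mat 1) x = fst (mat_trace x)"
proof -
  have "scale (mat 1 $ i $ j) v = (if i = j then v else 0)" for i j :: 'n and v
    by (simp add: mat_def)
  then show ?thesis
    by (simp add: trace_pairing_def mat_trace_def fst_sum)
qed

end

lemma mat_1_nonzero: "mat 1 \<noteq> (0 :: 'a::zero_neq_one^'n^'n)"
  by (auto simp: mat_def vec_eq_iff)

text \<open>The rank one matrix \<open>r l\<^sup>T\<close> works, where \<open>r\<close> is in the
  right kernel of \<open>B\<close> and \<open>l\<close> in the left kernel of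
  \<open>A\<close>.\<close>

lemma singular_two_sided_annihilator:
  fixes A B :: "'f::field^'n^'n"
  assumes "\<not> invertible A" "\<not> invertible B"
  obtains M where "M \<noteq> 0" "M ** A = 0" "B ** M = 0"
proof -
  have "\<not> invertible (transpose A)"
    using assms(1) by (simp add: invertible_det_nz det_transpose)
  then obtain l where l: "l v* A = 0" "l \<noteq> 0"
    by (auto simp: invertible_left_inverse matrix_left_invertible_ker)
  obtain r where r: "B *v r = 0" "r \<noteq> 0"
    using assms(2) by (auto simp: invertible_left_inverse matrix_left_invertible_ker)
  define M :: "'f^'n^'n" where "M = (\<chi> i j. r $ i * l $ j)"
  show thesis
  proof
    show "M \<noteq> 0"
      using l(2) r(2) by (auto simp: M_def vec_eq_iff)
    have "(\<Sum>k\<in>UNIV. r $ i * l $ k * A $ k $ j) = r $ i * (l v* A) $ j" for i j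
      by (simp add: vector_matrix_mult_def sum_distrib_left mult_ac)
    then show "M ** A = 0"
      by (simp add: M_def matrix_matrix_mult_def vec_eq_iff l(1))
    have "(\<Sum>k\<in>UNIV. B $ i $ k * (r $ k * l $ j)) = (B *v r) $ i * l $ j" for i j
      by (simp add: matrix_vector_mult_def sum_distrib_right mult.assoc)
    then show "B ** M = 0"
      by (simp add: M_def matrix_matrix_mult_def vec_eq_iff r(1))
  qed
qed

lemma (in vector_space) trace_zero_product_annihilated:
  fixes xs :: "(('b \<times> 'a)^'n^'n) list"
  assumes mul: "\<And>x y. mul x y = 0"
    and "\<forall>x\<in>set xs. mat_trace x = 0"
    and "scalar_part (foldr (mat_mult (unitization_mult scale mul)) xs (mat_one unitization_one)) = 0"
  obtains M where "M \<noteq> 0"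
    "trace_pairing scale M
       (foldr (mat_mult (unitization_mult scale mul)) xs (mat_one unitization_one)) = 0"
  using assms(2-)
proof (induction xs arbitrary: thesis)
  \<comment> \<open>Vacuous: the empty product has scalar part \<open>mat 1\<close>, which is
    nonzero.\<close>
  case Nil
  then show ?case
    by (simp add: scalar_part_one mat_1_nonzero)
next
  case (Cons x xs)
  define y where "y = foldr (mat_mult (unitization_mult scale mul)) xs (mat_one unitization_one)"
  let ?A = "scalar_part x" and ?B = "scalar_part y"
  have tr: "mat_trace x = 0"
    using Cons.prems by simp
  have AB: "?A ** ?B = 0"
    using Cons.prems(3) by (simp add: scalar_part_mult y_def)
  have pairing: "trace_pairing scale M
      (foldr (mat_mult (unitization_mult scale mul)) (x # xs) (mat_one unitization_one)) =
      trace_pairing scale (M ** ?A) y + trace_pairing scale (?B ** M) x" for M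
    by (simp add: y_def trace_pairing_mult[OF mul])
  show ?case
  proof (cases "invertible ?A")
    case True
    then obtain A' where A': "A' ** ?A = mat 1"
      by (auto simp: invertible_left_inverse)
    have "?B = (A' ** ?A) ** ?B"
      by (simp add: A')
    then have B: "?B = 0"
      by (simp add: AB flip: matrix_mul_assoc)
    obtain N where N: "N \<noteq> 0" "trace_pairing scale N y = 0"
      using Cons.IH Cons.prems(2) B by (auto simp: y_def)
    have NA: "(N ** A') ** ?A = N"
      by (simp add: A' flip: matrix_mul_assoc)
    show ?thesis
    proof (rule Cons.prems(1))
      show "N ** A' \<noteq> 0"
        using NA N(1) by auto
      show "trace_pairing scale (N ** A')
          (foldr (mat_mult (unitization_mult scale mul)) (x # xs) (mat_one unitization_one)) = 0"
        unfolding pairing NA by (simp add: N(2) B trace_pairing_zero)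
    qed
  next
    case singA: False
    show ?thesis
    proof (cases "invertible ?B")
      case True
      then obtain B' where B': "?B ** B' = mat 1"
        by (auto simp: invertible_right_inverse)
      have "?A = ?A ** (?B ** B')"
        by (simp add: B')
      then have A: "?A = 0"
        by (simp add: AB matrix_mul_assoc)
      show ?thesis
      proof (rule Cons.prems(1))
        show "B' \<noteq> 0"
          using B' mat_1_nonzero by force
        show "trace_pairing scale B'
            (foldr (mat_mult (unitization_mult scale mul)) (x # xs) (mat_one unitization_one)) = 0"
          unfolding pairing B' by (simp add: A tr trace_pairing_zero trace_pairing_one)
      qed
    next
      case False
      obtain M where M: "M \<noteq> 0" "M ** ?A = 0" "?B ** M = 0"
        using singular_two_sided_annihilator[OF singA False] .
      show ?thesis
        using M(1) by (rule Cons.prems(1)) (simp only: pairing M trace_pairing_zero add_0)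
    qed
  qed
qed

lemma mat_trace_mult_commute:
  assumes "\<And>x y. mul x y = mul y x"
  shows "mat_trace (mat_mult mul A B) = mat_trace (mat_mult mul B A)"
proof -
  have "(\<Sum>i\<in>UNIV. \<Sum>k\<in>UNIV. mul (A $ i $ k) (B $ k $ i)) =
      (\<Sum>k\<in>UNIV. \<Sum>i\<in>UNIV. mul (B $ k $ i) (A $ i $ k))"
    by (subst sum.swap) (simp add: assms)
  then show ?thesis
    by (simp add: mat_trace_def mat_mult_def)
qed

text \<open>Reduces the claim on commutators to the one on \<open>sl2\<close>; over commuting
  entries the trace does not see the order of two factors.\<close>

lemma commutators_subset_sl2:
  assumes "\<And>x y. mul x y = mul y x"
  shows "commutators (mat_mult mul) \<subseteq> sl2"
proof -
  have "mat_trace (X - Y) = mat_trace X - mat_trace Y" for X Y :: "'a^2^2"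
    by (simp add: mat_trace_def sum_subtractf)
  then show ?thesis
    using mat_trace_mult_commute[of mul, OF assms]
    by (fastforce simp: commutators_def commutator_def sl2_def)
qed

lemma finite_products_mono: "S \<subseteq> T \<Longrightarrow> finite_products mul e S \<subseteq> finite_products mul e T"
  by (fastforce simp: finite_products_def)

lemma (in vector_space) independent_four:
  assumes "distinct [c1, c2, c3, c4]" "independent {c1, c2, c3, c4}"
    and "scale k1 c1 + scale k2 c2 + scale k3 c3 + scale k4 c4 = 0"
  shows "k1 = 0" "k2 = 0" "k3 = 0" "k4 = 0"
proof -
  \<comment> \<open>Distinctness makes \<open>u\<close> take the value \<open>ki\<close> at each
    \<open>ci\<close>; the default \<open>k4\<close> elsewhere is harmless, as only these four
    values enter the sum.\<close>
  define u where "u v = (if v = c1 then k1 else if v = c2 then k2 else if v = c3 then k3 else k4)" for v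
  have "(\<Sum>v\<in>{c1, c2, c3, c4}. scale (u v) v) = 0"
    using assms(1,3) by (auto simp: u_def add.assoc)
  then have "\<forall>v\<in>{c1, c2, c3, c4}. u v = 0"
    using assms(2) independent_explicit_finite_subsets[of "{c1, c2, c3, c4}"] by blast
  then show "k1 = 0" "k2 = 0" "k3 = 0" "k4 = 0"
    using assms(1) by (auto simp: u_def split: if_splits)
qed

theorem theorem2p2:
  fixes smul :: "'f::field \<Rightarrow> 'b::ab_group_add \<Rightarrow> 'b"
    and mul :: "'b \<Rightarrow> 'b \<Rightarrow> 'b"
    and c1 c2 c3 c4 :: 'b
    and mulC :: "'b \<times> 'f \<Rightarrow> 'b \<times> 'f \<Rightarrow> 'b \<times> 'f"
    and mulM :: "('b \<times> 'f)^2^2 \<Rightarrow> ('b \<times> 'f)^2^2 \<Rightarrow> ('b \<times> 'f)^2^2"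
    and oneM a :: "('b \<times> 'f)^2^2"
  assumes "nonunital_algebra smul mul"
    and "vector_space.dim smul UNIV = 4"
    and "\<And>x y. mul x y = 0"
    and "distinct [c1, c2, c3, c4]"
    and "\<not> module.dependent smul {c1, c2, c3, c4}"
    and "module.span smul {c1, c2, c3, c4} = UNIV"
  defines "mulC \<equiv> unitization_mult smul mul"
    and "mulM \<equiv> mat_mult mulC"
    and "oneM \<equiv> mat_one unitization_one"
    and "a \<equiv> vector [vector [(c1, 0), (c2, 0)], vector [(c3, 0), (c4, 0)]]"
  shows "a \<notin> finite_products mulM oneM sl2 \<and>
    a \<notin> finite_products mulM oneM (commutators mulM)"
proof -
  interpret nonunital_algebra smul mul by fact
  have "a \<notin> finite_products mulM oneM sl2"
  proof
    assume "a \<in> finite_products mulM oneM sl2"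
    then obtain xs where xs: "a = foldr mulM xs oneM" "\<forall>x\<in>set xs. mat_trace x = 0"
      by (auto simp: finite_products_def sl2_def)
    have "scalar_part a = 0"
      by (simp add: a_def scalar_part_def vec_eq_iff forall_2)
    then obtain M where M: "M \<noteq> 0" "trace_pairing smul M a = 0"
      using trace_zero_product_annihilated[of mul xs] xs assms(3)
      unfolding mulM_def mulC_def oneM_def by metis
    \<comment> \<open>The trace pairs entry \<open>(i, j)\<close> of \<open>M\<close> with entry
      \<open>(j, i)\<close> of \<open>a\<close>, hence the transposed indices at \<open>c2\<close>
      and \<open>c3\<close>.\<close>
    have "smul (M $ 1 $ 1) c1 + smul (M $ 2 $ 1) c2 + smul (M $ 1 $ 2) c3 + smul (M $ 2 $ 2) c4 = 0"
      using M(2) by (simp add: trace_pairing_def sum_2 a_def algebra_simps)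
    then have "M = 0"
      using independent_four[OF assms(4,5)] by (simp add: vec_eq_iff forall_2)
    with M(1) show False ..
  qed
  moreover have "finite_products mulM oneM (commutators mulM) \<subseteq> finite_products mulM oneM sl2"
    unfolding mulM_def mulC_def
    by (intro finite_products_mono commutators_subset_sl2 unitization_commute) (simp add: assms(3))
  ultimately show ?thesis
    by blast
qed

end
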